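(* Let $A^1\subseteq\mathbb{R}^q$ and $A^2\subseteq\mathbb{R}^q$ be polyhedra with P-representations $(M^1,B^1,a^1,b^1,l^1,u^1)$ and $(M^2,B^2,a^2,b^2,l^2,u^2)$, respectively. Then the Minkowski sum $$A^1+A^2=\{y\in\mathbb{R}^q \mid \exists\, y^1\in A^1,\ y^2\in A^2 :\ y=y^1+y^2\}$$ has the P-representation $$\left(\begin{pmatrix} M^1 & M^2\end{pmatrix},\ \begin{pmatrix} B^1 & 0\\ 0 & B^2\end{pmatrix},\ \begin{pmatrix} a^1\\ a^2\end{pmatrix},\ \begin{pmatrix} b^1\\ b^2\end{pmatrix},\ \begin{pmatrix} l^1\\ l^2\end{pmatrix},\ \begin{pmatrix} u^1\\ u^2\end{pmatrix}\right).$$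
   Context: Given matrices $M\in\mathbb{R}^{q\times n}$, $B\in\mathbb{R}^{m\times n}$ and vectors $a\in(\mathbb{R}\cup\{-\infty\})^m$, $b\in(\mathbb{R}\cup\{+\infty\})^m$, $l\in(\mathbb{R}\cup\{-\infty\})^n$, $u\in(\mathbb{R}\cup\{+\infty\})^n$, the set $P=\{Mx \mid x\in\mathbb{R}^n,\ a\le Bx\le b,\ l\le x\le u\}\subseteq\mathbb{R}^q$ (inequalities componentwise) is called a (convex) polyhedron, and the tuple $(M,B,a,b,l,u)$ is called a P-representation of $P$. The two P-representations may have different numbers of variables and constraints: $M^i\in\mathbb{R}^{q\times n_i}$, $B^i\in\mathbb{R}^{m_i\times n_i}$ for $i=1,2$. The symbol $0$ in block matrices denotes zero blocks of appropriate size. *)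

theory Defs
  imports "Jordan_Normal_Form.Matrix" "HOL-Library.Extended_Real"
begin

definition append_cols :: "'a :: zero mat \<Rightarrow> 'a mat \<Rightarrow> 'a mat" (infixr \<open>@\<^sub>c\<close> 65) where
  "A @\<^sub>c B = four_block_mat A B (0\<^sub>m 0 (dim_col A)) (0\<^sub>m 0 (dim_col B))"

lemma append_cols_carrier [simp, intro]:
  "A \<in> carrier_mat nr nc1 \<Longrightarrow> B \<in> carrier_mat nr nc2 \<Longrightarrow> A @\<^sub>c B \<in> carrier_mat nr (nc1 + nc2)"
  by (auto simp: append_cols_def)

lemma index_append_cols:
  "A \<in> carrier_mat nr nc1 \<Longrightarrow> B \<in> carrier_mat nr nc2 \<Longrightarrow> i < nr \<Longrightarrow> j < nc1 + nc2 \<Longrightarrow>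
    (A @\<^sub>c B) $$ (i, j) = (if j < nc1 then A $$ (i, j) else B $$ (i, j - nc1))"
  by (auto simp: append_cols_def)

type_synonym P_data =
  "real mat \<times> real mat \<times> ereal vec \<times> ereal vec \<times> ereal vec \<times> ereal vec"

(* Lower bounds may be minus infinity but not plus infinity; upper bounds the other way round. *)
fun P_data_dims :: "nat \<Rightarrow> nat \<Rightarrow> nat \<Rightarrow> P_data \<Rightarrow> bool" where
  "P_data_dims q m n (M, B, a, b, l, u) \<longleftrightarrow>
     M \<in> carrier_mat q n \<and> B \<in> carrier_mat m n \<and>
     a \<in> carrier_vec m \<and> b \<in> carrier_vec m \<and> l \<in> carrier_vec n \<and> u \<in> carrier_vec n \<and>
     (\<forall>i < m. a $ i \<noteq> \<infinity> \<and> b $ i \<noteq> -\<infinity>) \<and>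
     (\<forall>j < n. l $ j \<noteq> \<infinity> \<and> u $ j \<noteq> -\<infinity>)"

(* The order on vectors is the componentwise one of the library. *)
fun P_set :: "P_data \<Rightarrow> real vec set" where
  "P_set (M, B, a, b, l, u) =
     {M *\<^sub>v x | x. x \<in> carrier_vec (dim_col M) \<and>
        a \<le> map_vec ereal (B *\<^sub>v x) \<and> map_vec ereal (B *\<^sub>v x) \<le> b \<and>
        l \<le> map_vec ereal x \<and> map_vec ereal x \<le> u}"

definition P_representation :: "nat \<Rightarrow> nat \<Rightarrow> nat \<Rightarrow> P_data \<Rightarrow> real vec set \<Rightarrow> bool" where
  "P_representation q m n R P \<longleftrightarrow> P_data_dims q m n R \<and> P = P_set R"

end

theory Submission
  imports Defs
begin

text \<open>
  The vectors of dimension \<open>n1 + n2\<close> are exactly the concatenations \<open>x1 @\<^sub>v x2\<close> of vectors of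
  dimensions \<open>n1\<close> and \<open>n2\<close>.  On such a concatenation the combined data decouple: the
  block-diagonal constraint matrix sends it to \<open>B1 x1\<close> stacked on \<open>B2 x2\<close>, so that, the order being
  componentwise, it is feasible if and only if \<open>x1\<close> and \<open>x2\<close> are feasible for the two given systems
  independently (\<open>append_vec_feasible_iff\<close>).  The two parts are coupled only by the objective matrix,
  which sends the concatenation to \<open>M1 x1 + M2 x2\<close> (\<open>append_cols_mult_append_vec\<close>).  As \<open>x1\<close> and \<open>x2\<close>
  range freely over the two feasible sets, these values range over all sums of a point of \<open>A1\<close> and a
  point of \<open>A2\<close>.
\<close>

lemma append_cols_mult_append_vec:
  fixes A B :: "'a :: comm_semiring_0 mat"
  assumes A: "A \<in> carrier_mat nr nc1" and B: "B \<in> carrier_mat nr nc2"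
    and x: "x \<in> carrier_vec nc1" and y: "y \<in> carrier_vec nc2"
  shows "(A @\<^sub>c B) *\<^sub>v (x @\<^sub>v y) = A *\<^sub>v x + B *\<^sub>v y"
proof -
  have "(A @\<^sub>c B) *\<^sub>v (x @\<^sub>v y)
    = (A *\<^sub>v x + B *\<^sub>v y) @\<^sub>v (0\<^sub>m 0 nc1 *\<^sub>v x + 0\<^sub>m 0 nc2 *\<^sub>v y)"
    unfolding append_cols_def using A B x y
    by (subst four_block_mat_mult_vec[of _ nr nc1 _ nc2 _ 0]) auto
  \<comment> \<open>The second part has dimension 0.\<close>
  also have "\<dots> = A *\<^sub>v x + B *\<^sub>v y"
    by (rule eq_vecI) auto
  finally show ?thesis .
qed

lemma map_append_vec: "map_vec f (v @\<^sub>v w) = map_vec f v @\<^sub>v map_vec f w"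
  by (rule eq_vecI) auto

lemma ex_vec_append:
  "(\<exists>x \<in> carrier_vec (n + m). P x)
    \<longleftrightarrow> (\<exists>x1 \<in> carrier_vec n. \<exists>x2 \<in> carrier_vec m. P (x1 @\<^sub>v x2))"
  using all_vec_append[of n m "\<lambda>x. \<not> P x"] by blast

definition P_feasible ::
    "real mat \<Rightarrow> ereal vec \<Rightarrow> ereal vec \<Rightarrow> ereal vec \<Rightarrow> ereal vec \<Rightarrow> real vec \<Rightarrow> bool" where
  "P_feasible B a b l u x \<longleftrightarrow>
     a \<le> map_vec ereal (B *\<^sub>v x) \<and> map_vec ereal (B *\<^sub>v x) \<le> b \<and>
     l \<le> map_vec ereal x \<and> map_vec ereal x \<le> u"

lemma mem_P_set_iff:
  assumes "M \<in> carrier_mat q n"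
  shows "y \<in> P_set (M, B, a, b, l, u)
    \<longleftrightarrow> (\<exists>x \<in> carrier_vec n. P_feasible B a b l u x \<and> y = M *\<^sub>v x)"
  using assms by (auto simp: P_feasible_def)

text \<open>
  The zero off-diagonal blocks keep each group of variables out of the other group's constraints.
  Every inequality between concatenations splits because the two sides are cut at the same place.
\<close>

lemma append_vec_feasible_iff:
  assumes B1: "B1 \<in> carrier_mat m1 n1" and B2: "B2 \<in> carrier_mat m2 n2"
    and ab1: "a1 \<in> carrier_vec m1" "b1 \<in> carrier_vec m1"
    and lu1: "l1 \<in> carrier_vec n1" "u1 \<in> carrier_vec n1"
    and x1: "x1 \<in> carrier_vec n1" and x2: "x2 \<in> carrier_vec n2"
  shows "P_feasible (four_block_mat B1 (0\<^sub>m m1 n2) (0\<^sub>m m2 n1) B2)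
      (a1 @\<^sub>v a2) (b1 @\<^sub>v b2) (l1 @\<^sub>v l2) (u1 @\<^sub>v u2) (x1 @\<^sub>v x2)
    \<longleftrightarrow> P_feasible B1 a1 b1 l1 u1 x1 \<and> P_feasible B2 a2 b2 l2 u2 x2"
proof -
  have "four_block_mat B1 (0\<^sub>m m1 n2) (0\<^sub>m m2 n1) B2 *\<^sub>v (x1 @\<^sub>v x2) = (B1 *\<^sub>v x1) @\<^sub>v (B2 *\<^sub>v x2)"
    using B1 B2 x1 x2
    by (subst four_block_mat_mult_vec[of _ m1 n1 _ n2 _ m2]) auto
  moreover have y1: "map_vec ereal (B1 *\<^sub>v x1) \<in> carrier_vec m1"
    using B1 x1 by simp
  moreover have x1': "map_vec ereal x1 \<in> carrier_vec n1"
    using x1 by simp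
  ultimately show ?thesis
    unfolding P_feasible_def
    using append_vec_le[OF ab1(1) y1] append_vec_le[OF y1 ab1(2)]
      append_vec_le[OF lu1(1) x1'] append_vec_le[OF x1' lu1(2)]
    by (auto simp: map_append_vec)
qed

lemma all_index_append_vec_iff:
  assumes "v \<in> carrier_vec n" and "w \<in> carrier_vec m"
  shows "(\<forall>i < n + m. P ((v @\<^sub>v w) $ i)) \<longleftrightarrow> (\<forall>i < n. P (v $ i)) \<and> (\<forall>i < m. P (w $ i))"
    (is "?L \<longleftrightarrow> ?R")
proof
  assume L: ?L
  have "P (v $ i)" if "i < n" for i
    using L[rule_format, of i] that assms by auto
  moreover have "P (w $ i)" if "i < m" for i
    using L[rule_format, of "n + i"] that assms by auto
  ultimately show ?R
    by blast
next
  assume ?R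
  then show ?L
    using assms by auto
qed

lemma P_data_dims_append:
  assumes "P_data_dims q m1 n1 (M1, B1, a1, b1, l1, u1)"
    and "P_data_dims q m2 n2 (M2, B2, a2, b2, l2, u2)"
  shows "P_data_dims q (m1 + m2) (n1 + n2)
    (M1 @\<^sub>c M2, four_block_mat B1 (0\<^sub>m m1 n2) (0\<^sub>m m2 n1) B2,
     a1 @\<^sub>v a2, b1 @\<^sub>v b2, l1 @\<^sub>v l2, u1 @\<^sub>v u2)"
  using assms
  by (simp add: imp_conjR all_conj_distrib
      all_index_append_vec_iff[where P = "\<lambda>x. x \<noteq> c" for c] del: index_append_vec)

theorem proposition2:
  fixes q m1 n1 m2 n2 :: nat
    and M1 B1 M2 B2 :: "real mat"
    and a1 b1 l1 u1 a2 b2 l2 u2 :: "ereal vec"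
    and A1 A2 :: "real vec set"
  assumes "P_representation q m1 n1 (M1, B1, a1, b1, l1, u1) A1"
    and "P_representation q m2 n2 (M2, B2, a2, b2, l2, u2) A2"
  shows "P_representation q (m1 + m2) (n1 + n2)
    (M1 @\<^sub>c M2,
     four_block_mat B1 (0\<^sub>m m1 n2) (0\<^sub>m m2 n1) B2,
     a1 @\<^sub>v a2, b1 @\<^sub>v b2, l1 @\<^sub>v l2, u1 @\<^sub>v u2)
    {y \<in> carrier_vec q. \<exists>y1 \<in> A1. \<exists>y2 \<in> A2. y = y1 + y2}"
proof -
  let ?B = "four_block_mat B1 (0\<^sub>m m1 n2) (0\<^sub>m m2 n1) B2"
  let ?S = "P_set (M1 @\<^sub>c M2, ?B, a1 @\<^sub>v a2, b1 @\<^sub>v b2, l1 @\<^sub>v l2, u1 @\<^sub>v u2)"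
  let ?F1 = "P_feasible B1 a1 b1 l1 u1" and ?F2 = "P_feasible B2 a2 b2 l2 u2"
  have d1: "P_data_dims q m1 n1 (M1, B1, a1, b1, l1, u1)"
    and d2: "P_data_dims q m2 n2 (M2, B2, a2, b2, l2, u2)"
    and A1: "A1 = P_set (M1, B1, a1, b1, l1, u1)"
    and A2: "A2 = P_set (M2, B2, a2, b2, l2, u2)"
    using assms by (simp_all add: P_representation_def)
  have M1: "M1 \<in> carrier_mat q n1" and M2: "M2 \<in> carrier_mat q n2"
    using d1 d2 by auto
  have "y \<in> ?S \<longleftrightarrow> y \<in> carrier_vec q \<and> (\<exists>y1 \<in> A1. \<exists>y2 \<in> A2. y = y1 + y2)" for y
  proof -
    have "y \<in> ?S \<longleftrightarrow> (\<exists>x1 \<in> carrier_vec n1. \<exists>x2 \<in> carrier_vec n2.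
        P_feasible ?B (a1 @\<^sub>v a2) (b1 @\<^sub>v b2) (l1 @\<^sub>v l2) (u1 @\<^sub>v u2) (x1 @\<^sub>v x2)
        \<and> y = (M1 @\<^sub>c M2) *\<^sub>v (x1 @\<^sub>v x2))"
      by (simp only: mem_P_set_iff[OF append_cols_carrier[OF M1 M2]] ex_vec_append)
    also have "\<dots> \<longleftrightarrow> (\<exists>x1 \<in> carrier_vec n1. \<exists>x2 \<in> carrier_vec n2.
        (?F1 x1 \<and> ?F2 x2) \<and> y = M1 *\<^sub>v x1 + M2 *\<^sub>v x2)"
      using d1 d2
      by (intro bex_cong refl)
        (simp add: append_vec_feasible_iff append_cols_mult_append_vec[OF M1 M2])
    also have "\<dots> \<longleftrightarrow> (\<exists>y1 \<in> A1. \<exists>y2 \<in> A2. y = y1 + y2)"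
      unfolding A1 A2 Bex_def mem_P_set_iff[OF M1] mem_P_set_iff[OF M2] by blast
    also have "\<dots> \<longleftrightarrow> y \<in> carrier_vec q \<and> (\<exists>y1 \<in> A1. \<exists>y2 \<in> A2. y = y1 + y2)"
      unfolding A1 A2 Bex_def mem_P_set_iff[OF M1] mem_P_set_iff[OF M2] using M1 M2 by auto
    finally show ?thesis .
  qed
  then have "{y \<in> carrier_vec q. \<exists>y1 \<in> A1. \<exists>y2 \<in> A2. y = y1 + y2} = ?S"
    by blast
  with P_data_dims_append[OF d1 d2] show ?thesis
    unfolding P_representation_def by blast
qed

end
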